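(* Let $m\ge2$. Define a loss with action space $\mathbb R^{m-1}$ by, for $\tau\in\mathbb R^{m-1}$, $$L^{\mathrm{zo4}}(j,\tau)=1-\tilde\tau_j+S^{(j)}_\tau,\qquad j\in\{1,\ldots,m\},$$ where $(\tilde\tau_1,\ldots,\tilde\tau_{m-1})=(\tau_1,\ldots,\tau_{m-1})$, $\tilde\tau_m=1-\sum_{k=1}^{m-1}\tau_k$, and $$S^{(j)}_\tau=\max\left\{0,\ \tilde\tau_j-1,\ \frac{\tilde\tau_j+\tilde\tau_{j(1)}-1}{2},\ \ldots,\ \frac{\tilde\tau_j+\tilde\tau_{j(1)}+\cdots+\tilde\tau_{j(m-2)}-1}{m-1}\right\},$$ with $\tilde\tau_{j(1)}\ge\cdots\ge\tilde\tau_{j(m-1)}$ the sorted components of $\tilde\tau=(\tilde\tau_1,\ldots,\tilde\tau_m)^{T}$ excluding $\tilde\tau_j$. Then $L^{\mathrm{zo4}}(j,\tau)$ is convex in $\tau$, and coincides with $L^{\mathrm{zo2}}(j,\tilde\tau)=1-\tilde\tau_j$ provided $\tilde\tau\in\Delta_m$. Moreover, $L^{\mathrm{zo4}}$ induces the same generalized entropy $H^{\mathrm{zo}}$ as does the zero-one loss: for all $\eta\in\Delta_m$, $$\inf_{\tau\in\mathbb R^{m-1}}\sum_{j=1}^m\eta_jL^{\mathrm{zo4}}(j,\tau)=H^{\mathrm{zo}}(\eta)=1-\max_{k\in\{1,\ldots,m\}}\eta_k.$$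
   Context: $\Delta_m=\{q\in\mathbb R^m: q_j\ge0,\ \sum_jq_j=1\}$. The generalized entropy of a loss $L(j,\gamma)$ with action space $\mathcal A$ is $H_L(\eta)=\inf_{\gamma\in\mathcal A}\sum_j\eta_jL(j,\gamma)$, $\eta\in\Delta_m$. The zero-one loss is $L^{\mathrm{zo}}(j,\gamma)=1\{j\ne\mathrm{argmax}_k\gamma_k\}$, $\gamma\in\mathbb R^m$ (ties broken by any fixed rule), with generalized entropy $H^{\mathrm{zo}}(\eta)=1-\max_k\eta_k$. $L^{\mathrm{zo2}}(j,\lambda)=1-\lambda_j$ for $\lambda\in\Delta_m$. (For $m=2$ the maximum defining $S^{(j)}_\tau$ is over $\{0,\tilde\tau_j-1\}$.) *)

theory Defs
  imports "HOL-Analysis.Analysis" "HOL-Library.Multiset" "HOL-Library.Extended_Real"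
begin

text \<open>
  Class labels are the elements of a finite type, so that \<open>CARD('m)\<close> plays the role of \<open>m\<close>, and
  a loss is a function of a label and an action.
\<close>

definition prob_simplex :: "(real ^ 'm::finite) set"  where
  "prob_simplex = {q. (\<forall>j. 0 \<le> q $ j) \<and> (\<Sum>j\<in>UNIV. q $ j) = 1}"

text \<open>
  The infimum is taken in the extended reals, so that no junk value of \<open>Inf\<close> on the reals can
  enter when the expected loss is unbounded below.
\<close>

definition gen_entropy :: "('m::finite \<Rightarrow> 'a \<Rightarrow> real) \<Rightarrow> 'a set \<Rightarrow> real ^ 'm \<Rightarrow> ereal" where
  "gen_entropy L A \<eta> = (INF \<gamma>\<in>A. ereal (\<Sum>j\<in>UNIV. \<eta> $ j * L j \<gamma>))"

text \<open>A rule selecting a maximal component, i.e. an arbitrary fixed way of breaking ties.\<close>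

definition argmax_rule :: "(real ^ 'm::finite \<Rightarrow> 'm) \<Rightarrow> bool" where
  "argmax_rule am \<longleftrightarrow> (\<forall>\<gamma>. is_arg_max (\<lambda>k. \<gamma> $ k) (\<lambda>k. True) (am \<gamma>))"

definition loss_zo :: "(real ^ 'm::finite \<Rightarrow> 'm) \<Rightarrow> 'm \<Rightarrow> real ^ 'm \<Rightarrow> real" where
  "loss_zo am j \<gamma> = (if j \<noteq> am \<gamma> then 1 else 0)"

definition entropy_zo :: "(real ^ 'm::finite \<Rightarrow> 'm) \<Rightarrow> real ^ 'm \<Rightarrow> ereal" where
  "entropy_zo am \<eta> = gen_entropy (loss_zo am) UNIV \<eta>"

text \<open>Only meaningful for actions in \<^const>\<open>prob_simplex\<close>.\<close>

definition loss_zo2 :: "'m::finite \<Rightarrow> real ^ 'm \<Rightarrow> real" where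
  "loss_zo2 j q = 1 - q $ j"

text \<open>
  Vectors with \<open>m - 1\<close> components are indexed by \<open>'n\<close> and those with \<open>m\<close> components by
  \<open>'n option\<close>: \<open>Some k\<close> is the label \<open>k\<close> among the first \<open>m - 1\<close> labels, and \<open>None\<close> is the last
  label \<open>m\<close>. Since \<open>'n\<close> is nonempty, \<open>m \<ge> 2\<close>, and every \<open>m \<ge> 2\<close> arises in this way.
\<close>

definition tilde :: "real ^ 'n::finite \<Rightarrow> real ^ 'n option" where
  "tilde \<tau> = (\<chi> i. case i of Some k \<Rightarrow> \<tau> $ k | None \<Rightarrow> 1 - (\<Sum>k\<in>UNIV. \<tau> $ k))"

text \<open>The components other than the \<open>j\<close>-th, with multiplicity, in decreasing order.\<close>

definition sorted_others :: "'m::finite \<Rightarrow> real ^ 'm \<Rightarrow> real list" where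
  "sorted_others j t = rev (sorted_list_of_multiset {# t $ i. i \<in># mset_set (UNIV - {j}) #})"

text \<open>
  The term with index \<open>k\<close> adds the \<open>k\<close> largest other components; for \<open>m = 2\<close> only
  \<open>k = 0\<close> is present.
\<close>

definition S_term :: "'m::finite \<Rightarrow> real ^ 'm \<Rightarrow> real" where
  "S_term j t = Max (insert 0
     ((\<lambda>k. (t $ j + sum_list (take k (sorted_others j t)) - 1) / (real k + 1)) ` {0..CARD('m) - 2}))"

definition loss_zo4 :: "'n::finite option \<Rightarrow> real ^ 'n \<Rightarrow> real" where
  "loss_zo4 j \<tau> = 1 - tilde \<tau> $ j + S_term j (tilde \<tau>)"

end

theory Submission
  imports Defs
begin

text \<open>
  Since the components of \<open>t = tilde \<tau>\<close> sum to one, the zero in \<open>S_term j t\<close> is the value of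
  \<open>(t(B) - 1) / |B|\<close> at \<open>B = UNIV\<close>, so \<open>S_term j t\<close> is the maximum of this expression over all
  sets \<open>B\<close> of labels containing \<open>j\<close>: a maximum of affine functions of \<open>\<tau>\<close>, which vanishes on
  the simplex. For the entropy, let \<open>\<theta>\<close> be the maximum of \<open>(t(B) - 1) / |B|\<close> over all nonempty
  \<open>B\<close>, attained at \<open>C\<close>. Then \<open>t\<^sub>j - S\<^sub>j \<le> p\<^sub>j\<close>, where \<open>p\<close> is the projection of \<open>t\<close> to the simplex,
  equal to \<open>t\<^sub>j - \<theta> \<ge> 0\<close> on \<open>C\<close> and to \<open>0\<close> elsewhere. Hence the expected loss is at least
  \<open>1 - \<Sum> \<eta>\<^sub>j p\<^sub>j \<ge> 1 - max \<eta>\<close>, and the vertices of the simplex attain the bound.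
\<close>

section \<open>Sums over sets against prefixes of a sorted list\<close>

lemma sum_le_sum_list_take:
  fixes f :: "'a \<Rightarrow> real"
  assumes "sorted_wrt (\<lambda>x y. f y \<le> f x) xs" "A \<subseteq> set xs"
  shows "sum f A \<le> sum_list (take (card A) (map f xs))"
  using assms
proof (induction xs arbitrary: A)
  case Nil
  then show ?case by simp
next
  case (Cons x xs)
  have fin: "finite A" using Cons.prems(2) finite_subset by blast
  show ?case
  proof (cases "A = {}")
    case True
    then show ?thesis by simp
  next
    case False
    \<comment> \<open>The head \<open>x\<close> is chosen whenever it lies in \<open>A\<close>; in
      either case \<open>A - {a}\<close> consists of entries of the tail, and \<open>f a\<close> is
      at most \<open>f x\<close>.\<close>
    then obtain a where a: "a \<in> A" "x \<in> A \<Longrightarrow> a = x" by blast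
    have "f a \<le> f x"
      using Cons.prems a(1) by auto
    moreover have "sum f (A - {a}) \<le> sum_list (take (card (A - {a})) (map f xs))"
      using Cons.prems a by (intro Cons.IH) auto
    moreover have "card A = Suc (card (A - {a}))"
      using card.remove[OF fin a(1)] by simp
    ultimately show ?thesis
      using sum.remove[OF fin a(1), of f] by simp
  qed
qed

text \<open>Lifts the sorted list of values to an enumeration of labels, so that a prefix of the
  list becomes a set of labels even when components tie.\<close>

lemma sorted_others_enum:
  fixes j :: "'m::finite"
  obtains xs where "distinct xs" "set xs = UNIV - {j}"
    "sorted_others j t = map (\<lambda>i. t $ i) xs" "sorted_wrt (\<lambda>x y. t $ y \<le> t $ x) xs"
proof -
  let ?f = "\<lambda>i. t $ i"
  obtain ys where ys: "set ys = UNIV - {j}" "distinct ys"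
    using finite_distinct_list[of "UNIV - {j}"] by auto
  define xs where "xs = rev (sort_key ?f ys)"
  have "sort (map ?f ys) = map ?f (sort_key ?f ys)"
    by (rule properties_for_sort) (simp_all add: mset_map)
  moreover have "image_mset ?f (mset_set (UNIV - {j})) = mset (map ?f ys)"
    using ys by (metis mset_map mset_set_set)
  ultimately have "sorted_others j t = map ?f xs"
    unfolding sorted_others_def xs_def by (metis sorted_list_of_multiset_mset rev_map)
  moreover have "sorted_wrt (\<lambda>x y. t $ y \<le> t $ x) xs"
    using sorted_sort_key[of ?f ys] unfolding xs_def sorted_wrt_rev sorted_wrt_map by simp
  ultimately show thesis
    using that[of xs] ys by (simp add: xs_def)
qed

section \<open>The term S as a maximum over sets of labels\<close>

lemma S_term_nonneg: "0 \<le> S_term j t"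
  unfolding S_term_def by (rule Max_ge) auto

text \<open>Among the sets of a given size containing \<open>j\<close>, the sum is largest if the
  other labels carry the largest components. For \<open>UNIV\<close> the numerator vanishes.\<close>

lemma S_term_ge:
  fixes j :: "'m::finite"
  assumes "j \<in> B" "(\<Sum>i\<in>UNIV. t $ i) = 1"
  shows "((\<Sum>i\<in>B. t $ i) - 1) / real (card B) \<le> S_term j t"
proof (cases "B = UNIV")
  case True
  then show ?thesis using S_term_nonneg assms by simp
next
  case False
  obtain xs where xs: "set xs = UNIV - {j}" "sorted_others j t = map (\<lambda>i. t $ i) xs"
    "sorted_wrt (\<lambda>x y. t $ y \<le> t $ x) xs"
    using sorted_others_enum by metis
  let ?k = "card (B - {j})"
  have card: "card B = Suc ?k"
    using card.remove[of B j] assms by simp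
  have "(\<Sum>i\<in>B - {j}. t $ i) \<le> sum_list (take ?k (sorted_others j t))"
    unfolding xs(2) by (rule sum_le_sum_list_take) (use xs in auto)
  then have "(\<Sum>i\<in>B. t $ i) - 1 \<le> t $ j + sum_list (take ?k (sorted_others j t)) - 1"
    using sum.remove[of B j "\<lambda>i. t $ i"] assms by simp
  then have "((\<Sum>i\<in>B. t $ i) - 1) / real (card B)
      \<le> (t $ j + sum_list (take ?k (sorted_others j t)) - 1) / (real ?k + 1)"
    unfolding card by (simp add: divide_right_mono add.commute)
  \<comment> \<open>A proper subset has at most m - 1 elements, one of them \<open>j\<close>, so the
    index \<open>?k\<close> is at most m - 2.\<close>
  moreover have "card B < CARD('m)"
    using False by (intro psubset_card_mono) auto
  then have "?k \<in> {0..CARD('m) - 2}"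
    using card by auto
  then have "(t $ j + sum_list (take ?k (sorted_others j t)) - 1) / (real ?k + 1) \<le> S_term j t"
    unfolding S_term_def by (intro Max_ge) auto
  ultimately show ?thesis by simp
qed

lemma S_term_attained:
  fixes j :: "'m::finite"
  assumes "2 \<le> CARD('m)" "(\<Sum>i\<in>UNIV. t $ i) = 1"
  obtains B where "j \<in> B" "S_term j t = ((\<Sum>i\<in>B. t $ i) - 1) / real (card B)"
proof -
  have "S_term j t \<in> insert 0 ((\<lambda>k. (t $ j + sum_list (take k (sorted_others j t)) - 1)
      / (real k + 1)) ` {0..CARD('m) - 2})"
    unfolding S_term_def by (rule Max_in) auto
  then consider "S_term j t = 0" | k where "k \<le> CARD('m) - 2"
    "S_term j t = (t $ j + sum_list (take k (sorted_others j t)) - 1) / (real k + 1)"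
    by auto
  then show thesis
  proof cases
    case 1
    then show thesis using that[of UNIV] assms by simp
  next
    case (2 k)
    obtain xs where xs: "distinct xs" "set xs = UNIV - {j}"
      "sorted_others j t = map (\<lambda>i. t $ i) xs"
      using sorted_others_enum by metis
    let ?A = "set (take k xs)"
    have len: "length xs = CARD('m) - 1"
      using distinct_card[OF xs(1)] xs(2) by simp
    have A: "j \<notin> ?A" using xs(2) set_take_subset[of k xs] by auto
    have "card ?A = k"
      using distinct_card[OF distinct_take[OF xs(1)], of k] len 2(1) by simp
    moreover have "sum_list (take k (sorted_others j t)) = (\<Sum>i\<in>?A. t $ i)"
      unfolding xs(3) take_map
      using sum_list_distinct_conv_sum_set[OF distinct_take[OF xs(1)]] by blast
    ultimately show thesis
      using that[of "insert j ?A"] A 2(2) by (simp add: add.commute)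
  qed
qed

section \<open>Convexity and the values on the simplex\<close>

lemma sum_tilde: "(\<Sum>i\<in>UNIV. tilde \<tau> $ i) = 1"
  by (simp add: UNIV_option_conv sum.reindex tilde_def)

text \<open>The last component of \<open>tilde\<close> has constant term 1, which only combinations
  with total weight 1 reproduce.\<close>

lemma tilde_affine:
  assumes "u + v = 1"
  shows "tilde (u *\<^sub>R x + v *\<^sub>R y) $ i = u * tilde x $ i + v * tilde y $ i"
proof (cases i)
  case None
  have "u * (1 - a) + v * (1 - b) = 1 - (u * a + v * b)" for a b
    using assms by (simp add: algebra_simps)
  then show ?thesis
    by (simp add: None tilde_def sum.distrib sum_distrib_left)
next
  case (Some k)
  then show ?thesis by (simp add: tilde_def)
qed

lemma card_option_ge_2: "2 \<le> CARD('n::finite option)"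
proof -
  have "0 < CARD('n)" by simp
  then show ?thesis by (simp add: card_UNIV_option)
qed

text \<open>The set attaining the maximum at the intermediate point gives an affine function that
  equals S there and is at most S at both end points.\<close>

lemma convex_on_loss_zo4:
  fixes j :: "'n::finite option"
  shows "convex_on UNIV (loss_zo4 j)"
proof (rule convex_onI)
  fix r :: real and x y :: "real ^ 'n"
  assume r: "0 < r" "r < 1"
  define z where "z = (1 - r) *\<^sub>R x + r *\<^sub>R y"
  have z: "tilde z $ i = (1 - r) * tilde x $ i + r * tilde y $ i" for i
    unfolding z_def by (rule tilde_affine) simp
  obtain B where B: "j \<in> B" "S_term j (tilde z) = ((\<Sum>i\<in>B. tilde z $ i) - 1) / real (card B)"
    using S_term_attained[OF card_option_ge_2 sum_tilde] by metis
  let ?a = "\<lambda>w. ((\<Sum>i\<in>B. tilde w $ i) - 1) / real (card B)"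
  have "?a z = (1 - r) * ?a x + r * ?a y"
    by (simp add: z sum.distrib sum_distrib_left[symmetric] add_divide_distrib[symmetric])
      (simp add: algebra_simps)
  also have "\<dots> \<le> (1 - r) * S_term j (tilde x) + r * S_term j (tilde y)"
    using r B(1) by (intro add_mono mult_left_mono S_term_ge sum_tilde) auto
  finally show "loss_zo4 j ((1 - r) *\<^sub>R x + r *\<^sub>R y) \<le> (1 - r) * loss_zo4 j x + r * loss_zo4 j y"
    unfolding loss_zo4_def z_def[symmetric] z B(2) by (simp add: algebra_simps)
qed simp

text \<open>With nonnegative components every partial sum is at most 1, so no term of the maximum is
  positive.\<close>

lemma loss_zo4_on_simplex:
  assumes "tilde \<tau> \<in> prob_simplex"
  shows "loss_zo4 j \<tau> = 1 - tilde \<tau> $ j"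
proof -
  obtain B where "S_term j (tilde \<tau>) = ((\<Sum>i\<in>B. tilde \<tau> $ i) - 1) / real (card B)"
    using S_term_attained[OF card_option_ge_2 sum_tilde] by metis
  moreover have "(\<Sum>i\<in>B. tilde \<tau> $ i) \<le> (\<Sum>i\<in>UNIV. tilde \<tau> $ i)"
    using assms by (intro sum_mono2) (auto simp: prob_simplex_def)
  ultimately have "S_term j (tilde \<tau>) \<le> 0"
    by (simp add: sum_tilde divide_le_0_iff)
  then show ?thesis
    using S_term_nonneg[of j "tilde \<tau>"] by (simp add: loss_zo4_def)
qed

section \<open>The lower bound for the expected loss\<close>

lemma sum_minus_S_term_le:
  fixes t \<eta> :: "real ^ 'm::finite"
  assumes t: "(\<Sum>i\<in>UNIV. t $ i) = 1" and nonneg: "\<And>j. 0 \<le> \<eta> $ j" and M: "\<And>j. \<eta> $ j \<le> M"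
  shows "(\<Sum>j\<in>UNIV. \<eta> $ j * (t $ j - S_term j t)) \<le> M"
proof -
  define g where "g = (\<lambda>B. ((\<Sum>i\<in>B. t $ i) - 1) / real (card B))"
  define \<theta> where "\<theta> = Max (g ` {B. B \<noteq> {}})"
  have "\<theta> \<in> g ` {B. B \<noteq> {}}"
    unfolding \<theta>_def by (rule Max_in) auto
  then obtain C where C: "C \<noteq> {}" "\<theta> = g C" by auto
  have \<theta>_ge: "(\<Sum>i\<in>B. t $ i) - 1 \<le> \<theta> * real (card B)" if "B \<noteq> {}" for B
  proof -
    have "g B \<le> \<theta>" unfolding \<theta>_def by (rule Max_ge) (use that in auto)
    moreover have "0 < real (card B)" using that by (simp add: card_gt_0_iff)
    ultimately show ?thesis by (simp add: g_def divide_le_eq)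
  qed
  have C_eq: "(\<Sum>i\<in>C. t $ i) - 1 = \<theta> * real (card C)"
    using C by (simp add: g_def)
  \<comment> \<open>Removing \<open>j\<close> from \<open>C\<close> lowers the left side of
    \<open>C_eq\<close> by \<open>t $ j\<close> and the right side by \<theta>; the inequality for
    \<open>C - {j}\<close> then gives the claim. If that set is empty, it reads -1 \<le> 0.\<close>
  have inside: "\<theta> \<le> t $ j" if "j \<in> C" for j
  proof -
    have "(\<Sum>i\<in>C - {j}. t $ i) - 1 \<le> \<theta> * real (card (C - {j}))"
    proof (cases "C - {j} = {}")
      case True
      show ?thesis unfolding True by simp
    qed (rule \<theta>_ge)
    moreover have "\<theta> * real (card C) = \<theta> + \<theta> * real (card (C - {j}))"
      using card.remove[OF finite that] by (simp only: of_nat_Suc distrib_left mult_1_right)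
    moreover have "(\<Sum>i\<in>C. t $ i) = t $ j + (\<Sum>i\<in>C - {j}. t $ i)"
      using that by (intro sum.remove) auto
    ultimately show ?thesis
      using C_eq by linarith
  qed
  have outside: "t $ j \<le> S_term j t" if "j \<notin> C" for j
  proof -
    have sum: "(\<Sum>i\<in>insert j C. t $ i) - 1 = t $ j + \<theta> * real (card C)"
      using C_eq that by simp
    have "t $ j \<le> \<theta>"
      using \<theta>_ge[of "insert j C"] sum that by (simp add: algebra_simps)
    \<comment> \<open>The quotient for \<open>insert j C\<close> is a weighted mean of
      \<open>t $ j\<close> (weight 1) and \<theta> (weight \<open>card C\<close>), hence at least
      \<open>t $ j\<close>.\<close>
    then have "t $ j * real (card C) \<le> \<theta> * real (card C)"
      by (rule mult_right_mono) simp
    then have "t $ j \<le> ((\<Sum>i\<in>insert j C. t $ i) - 1) / real (card (insert j C))"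
      unfolding sum using that by (simp add: le_divide_eq algebra_simps)
    also have "\<dots> \<le> S_term j t" using t by (intro S_term_ge) auto
    finally show ?thesis .
  qed
  have "(\<Sum>j\<in>UNIV. \<eta> $ j * (t $ j - S_term j t))
      \<le> (\<Sum>j\<in>UNIV. if j \<in> C then M * (t $ j - \<theta>) else 0)"
  proof (rule sum_mono)
    fix j
    show "\<eta> $ j * (t $ j - S_term j t) \<le> (if j \<in> C then M * (t $ j - \<theta>) else 0)"
    proof (cases "j \<in> C")
      case True
      have "\<theta> \<le> S_term j t"
        using S_term_ge[OF True t] C(2) by (simp add: g_def)
      then have "\<eta> $ j * (t $ j - S_term j t) \<le> \<eta> $ j * (t $ j - \<theta>)"
        using nonneg by (intro mult_left_mono) auto
      also have "\<dots> \<le> M * (t $ j - \<theta>)"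
        using M inside[OF True] by (intro mult_right_mono) auto
      finally show ?thesis using True by simp
    next
      case False
      then show ?thesis
        using nonneg outside[OF False] by (simp add: mult_nonneg_nonpos)
    qed
  qed
  \<comment> \<open>By \<open>C_eq\<close> the weights \<open>t $ j - \<theta>\<close> on
    \<open>C\<close> have total mass 1.\<close>
  also have "\<dots> = M * ((\<Sum>j\<in>C. t $ j) - \<theta> * real (card C))"
    by (simp add: sum.If_cases sum_distrib_left[symmetric] sum_subtractf mult.commute)
  also have "\<dots> = M" using C_eq by simp
  finally show ?thesis .
qed

section \<open>Computation of the two entropies\<close>

lemma tilde_eq_axis: "\<exists>\<tau>. tilde \<tau> = axis k 1"
proof -
  have "tilde (\<chi> i. axis k 1 $ Some i) = axis k 1"
  proof (cases k)
    case None
    then show ?thesis by (simp add: vec_eq_iff tilde_def axis_def split: option.split)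
  next
    case (Some l)
    then show ?thesis by (simp add: vec_eq_iff tilde_def axis_def split: option.split)
  qed
  then show ?thesis by blast
qed

lemma axis_mem_prob_simplex: "axis k 1 \<in> prob_simplex"
  by (simp add: prob_simplex_def axis_def)

lemma sum_prob_simplex_one_minus:
  assumes "\<eta> \<in> prob_simplex"
  shows "(\<Sum>j\<in>UNIV. \<eta> $ j * (1 - f j)) = 1 - (\<Sum>j\<in>UNIV. \<eta> $ j * f j)"
  using assms by (simp add: prob_simplex_def right_diff_distrib sum_subtractf)

lemma gen_entropy_eqI:
  assumes "\<And>\<gamma>. \<gamma> \<in> A \<Longrightarrow> c \<le> (\<Sum>j\<in>UNIV. \<eta> $ j * L j \<gamma>)"
    and "\<gamma>\<^sub>0 \<in> A" "(\<Sum>j\<in>UNIV. \<eta> $ j * L j \<gamma>\<^sub>0) = c"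
  shows "gen_entropy L A \<eta> = ereal c"
  unfolding gen_entropy_def
proof (rule antisym)
  show "(INF \<gamma>\<in>A. ereal (\<Sum>j\<in>UNIV. \<eta> $ j * L j \<gamma>)) \<le> ereal c"
    using assms(2,3) by (intro INF_lower2[of \<gamma>\<^sub>0]) auto
  show "ereal c \<le> (INF \<gamma>\<in>A. ereal (\<Sum>j\<in>UNIV. \<eta> $ j * L j \<gamma>))"
    using assms(1) by (intro INF_greatest) simp
qed

text \<open>The expected loss depends on the action only through the selected label, and the action
  \<eta> itself selects a maximal component.\<close>

lemma entropy_zo_eq:
  assumes "argmax_rule am" "\<eta> \<in> prob_simplex"
  shows "entropy_zo am \<eta> = ereal (1 - Max (range (\<lambda>k. \<eta> $ k)))"
proof -
  have loss: "(\<Sum>j\<in>UNIV. \<eta> $ j * loss_zo am j \<gamma>) = 1 - \<eta> $ am \<gamma>" for \<gamma>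
  proof -
    have "loss_zo am j \<gamma> = 1 - (if j = am \<gamma> then 1 else 0)" for j
      by (simp add: loss_zo_def)
    then have "(\<Sum>j\<in>UNIV. \<eta> $ j * loss_zo am j \<gamma>)
        = 1 - (\<Sum>j\<in>UNIV. \<eta> $ j * (if j = am \<gamma> then 1 else 0))"
      using sum_prob_simplex_one_minus[OF assms(2)] by presburger
    then show ?thesis by (simp add: if_distrib cong: if_cong)
  qed
  have max: "\<eta> $ k \<le> \<eta> $ am \<eta>" for k
    using assms(1) by (simp add: argmax_rule_def is_arg_max_linorder)
  then have "Max (range (\<lambda>k. \<eta> $ k)) = \<eta> $ am \<eta>"
    by (intro Max_eqI) auto
  then show ?thesis
    unfolding entropy_zo_def
    by (intro gen_entropy_eqI[where \<gamma>\<^sub>0 = \<eta>]) (simp_all add: loss max)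
qed

text \<open>The bound of \<open>sum_minus_S_term_le\<close>, with the largest component of \<eta> as
  \<open>M\<close>, is attained at the vertex of a label \<open>k\<close> maximizing \<eta>, where
  the loss is 0 for \<open>k\<close> and 1 for all other labels.\<close>

lemma gen_entropy_zo4_eq:
  fixes \<eta> :: "real ^ ('n::finite) option"
  assumes "\<eta> \<in> prob_simplex"
  shows "gen_entropy loss_zo4 UNIV \<eta> = ereal (1 - Max (range (\<lambda>k. \<eta> $ k)))"
proof -
  let ?M = "Max (range (\<lambda>k. \<eta> $ k))"
  have "?M \<in> range (\<lambda>k. \<eta> $ k)" by (rule Max_in) auto
  then obtain k where k: "?M = \<eta> $ k" by blast
  obtain \<tau> where \<tau>: "tilde \<tau> = axis k 1" using tilde_eq_axis by blast
  have "loss_zo4 j \<tau> = 1 - axis k 1 $ j" for j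
    using loss_zo4_on_simplex[of \<tau> j] \<tau> axis_mem_prob_simplex[of k] by simp
  then have "(\<Sum>j\<in>UNIV. \<eta> $ j * loss_zo4 j \<tau>) = 1 - (\<Sum>j\<in>UNIV. \<eta> $ j * axis k 1 $ j)"
    using sum_prob_simplex_one_minus[OF assms] by presburger
  then have attained: "(\<Sum>j\<in>UNIV. \<eta> $ j * loss_zo4 j \<tau>) = 1 - ?M"
    by (simp add: k axis_def if_distrib cong: if_cong)
  have "1 - ?M \<le> (\<Sum>j\<in>UNIV. \<eta> $ j * loss_zo4 j \<sigma>)" for \<sigma>
  proof -
    have "(\<Sum>j\<in>UNIV. \<eta> $ j * (tilde \<sigma> $ j - S_term j (tilde \<sigma>))) \<le> ?M"
      using assms by (intro sum_minus_S_term_le sum_tilde) (auto simp: prob_simplex_def)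
    moreover have "loss_zo4 j \<sigma> = 1 - (tilde \<sigma> $ j - S_term j (tilde \<sigma>))" for j
      by (simp add: loss_zo4_def)
    then have "(\<Sum>j\<in>UNIV. \<eta> $ j * loss_zo4 j \<sigma>)
        = 1 - (\<Sum>j\<in>UNIV. \<eta> $ j * (tilde \<sigma> $ j - S_term j (tilde \<sigma>)))"
      using sum_prob_simplex_one_minus[OF assms] by presburger
    ultimately show ?thesis by linarith
  qed
  then show ?thesis
    using attained by (intro gen_entropy_eqI[where \<gamma>\<^sub>0 = \<tau>]) auto
qed

theorem proposition6:
  fixes am :: "real ^ ('n::finite) option \<Rightarrow> 'n option"
  assumes "argmax_rule am"
  shows "(\<forall>j :: 'n option. convex_on UNIV (\<lambda>\<tau> :: real ^ 'n. loss_zo4 j \<tau>))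
       \<and> (\<forall>(j :: 'n option) (\<tau> :: real ^ 'n). tilde \<tau> \<in> prob_simplex \<longrightarrow>
            loss_zo4 j \<tau> = loss_zo2 j (tilde \<tau>) \<and> loss_zo2 j (tilde \<tau>) = 1 - tilde \<tau> $ j)
       \<and> (\<forall>\<eta> \<in> (prob_simplex :: (real ^ 'n option) set).
            gen_entropy loss_zo4 (UNIV :: (real ^ 'n) set) \<eta> = entropy_zo am \<eta>
            \<and> entropy_zo am \<eta> = ereal (1 - Max (range (\<lambda>k. \<eta> $ k))))"
proof (intro conjI allI ballI impI)
  fix j :: "'n option" and \<tau> :: "real ^ 'n"
  show "convex_on UNIV (\<lambda>\<tau> :: real ^ 'n. loss_zo4 j \<tau>)"
    by (rule convex_on_loss_zo4)
  show "loss_zo2 j (tilde \<tau>) = 1 - tilde \<tau> $ j"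
    by (rule loss_zo2_def)
  show "loss_zo4 j \<tau> = loss_zo2 j (tilde \<tau>)" if "tilde \<tau> \<in> prob_simplex"
    unfolding loss_zo2_def using that by (rule loss_zo4_on_simplex)
next
  fix \<eta> :: "real ^ 'n option"
  assume \<eta>: "\<eta> \<in> prob_simplex"
  show "entropy_zo am \<eta> = ereal (1 - Max (range (\<lambda>k. \<eta> $ k)))"
    using assms \<eta> by (rule entropy_zo_eq)
  then show "gen_entropy loss_zo4 (UNIV :: (real ^ 'n) set) \<eta> = entropy_zo am \<eta>"
    using gen_entropy_zo4_eq[OF \<eta>] by simp
qed

end
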